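(* The six $4\times4$ matrices $$U=|11\rangle\langle01|-|01\rangle\langle11|,\quad Y=i|11\rangle\langle01|+i|01\rangle\langle11|,$$ $$T=|11\rangle\langle10|-|10\rangle\langle11|,\quad X=i|11\rangle\langle10|+i|10\rangle\langle11|,$$ $$V=|10\rangle\langle00|-|00\rangle\langle10|,\quad Z=i|10\rangle\langle00|+i|00\rangle\langle10|$$ generate the Lie algebra $\mathfrak{su}(4)$ as a real Lie algebra under the commutator bracket. Consequently, the two-qubit gates $$\exp\!\big(-t(|1\delta\rangle\langle0\delta|-|0\delta\rangle\langle1\delta|)\big),\qquad \exp\!\big(-ti(|1\delta\rangle\langle0\delta|+|0\delta\rangle\langle1\delta|)\big),$$ for $\delta\in\{0,1\}$ and $-1\le t\le1$, applied to a pair of qubits in either order, form a universal set of two-qubit gates: every element of $SU(4)$ is a finite product of such gates.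
   Context: Two-qubit operators are $4\times4$ complex matrices in the basis $|00\rangle,|01\rangle,|10\rangle,|11\rangle$. $\mathfrak{su}(4)$ is the real Lie algebra of traceless anti-Hermitian $4\times4$ matrices. Applying a gate "in the other order" means conjugating it by the swap of the two qubits. *)

theory Defs
  imports "HOL-Analysis.Analysis"
begin

text \<open>Two-qubit operators: complex 4x4 matrices, index k :: 4 (values 0,1,2,3)
  corresponds to the basis ket |ab> with k = 2a + b, i.e. |00>,|01>,|10>,|11>.\<close>

type_synonym cmat4 = "complex^4^4"

definition ket_bra :: "4 \<Rightarrow> 4 \<Rightarrow> cmat4" where
  "ket_bra i j = (\<chi> r c. if r = i \<and> c = j then 1 else 0)"

text \<open>Basis index of |a b>.\<close>
definition qidx :: "nat \<Rightarrow> nat \<Rightarrow> 4" where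
  "qidx a b = of_nat (2 * a + b)"

definition cscale :: "complex \<Rightarrow> cmat4 \<Rightarrow> cmat4" where
  "cscale c A = (\<chi> i j. c * A$i$j)"

definition conj_transpose :: "cmat4 \<Rightarrow> cmat4" where
  "conj_transpose A = (\<chi> i j. cnj (A$j$i))"

definition commutator :: "cmat4 \<Rightarrow> cmat4 \<Rightarrow> cmat4" where
  "commutator A B = A ** B - B ** A"

text \<open>su(4): traceless anti-Hermitian 4x4 matrices (a real Lie algebra).\<close>
definition su4 :: "cmat4 set" where
  "su4 = {A. conj_transpose A = - A \<and> trace A = 0}"

text \<open>SU(4): unitary matrices with determinant 1.\<close>
definition SU4 :: "cmat4 set" where
  "SU4 = {A. A ** conj_transpose A = mat 1 \<and> det A = 1}"

text \<open>Real Lie algebra generated by S under the commutator bracket: the smallest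
  set containing S closed under real linear combinations and commutators.\<close>
inductive_set real_lie_gen :: "cmat4 set \<Rightarrow> cmat4 set" for S where
  gen: "x \<in> S \<Longrightarrow> x \<in> real_lie_gen S"
| zero: "0 \<in> real_lie_gen S"
| add: "x \<in> real_lie_gen S \<Longrightarrow> y \<in> real_lie_gen S \<Longrightarrow> x + y \<in> real_lie_gen S"
| scale: "x \<in> real_lie_gen S \<Longrightarrow> (r::real) *\<^sub>R x \<in> real_lie_gen S"
| bracket: "x \<in> real_lie_gen S \<Longrightarrow> y \<in> real_lie_gen S \<Longrightarrow> commutator x y \<in> real_lie_gen S"

text \<open>Matrix powers and the matrix exponential (entrywise power series).\<close>
primrec mpow :: "cmat4 \<Rightarrow> nat \<Rightarrow> cmat4" where
  "mpow A 0 = mat 1"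
| "mpow A (Suc n) = A ** mpow A n"

definition mexp :: "cmat4 \<Rightarrow> cmat4" where
  "mexp A = (\<chi> i j. \<Sum>n. (mpow A n)$i$j / of_nat (fact n))"

text \<open>Swap of the two qubits: |ab> \<mapsto> |ba>.\<close>
definition SWAP :: cmat4 where
  "SWAP = ket_bra 0 0 + ket_bra 1 2 + ket_bra 2 1 + ket_bra 3 3"

text \<open>The six generators.\<close>
definition gU :: cmat4 where "gU = ket_bra 3 1 - ket_bra 1 3"
definition gY :: cmat4 where "gY = cscale \<i> (ket_bra 3 1 + ket_bra 1 3)"
definition gT :: cmat4 where "gT = ket_bra 3 2 - ket_bra 2 3"
definition gX :: cmat4 where "gX = cscale \<i> (ket_bra 3 2 + ket_bra 2 3)"
definition gV :: cmat4 where "gV = ket_bra 2 0 - ket_bra 0 2"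
definition gZ :: cmat4 where "gZ = cscale \<i> (ket_bra 2 0 + ket_bra 0 2)"

text \<open>Basic gates exp(-t(|1d><0d| - |0d><1d|)) and exp(-t i(|1d><0d| + |0d><1d|)),
  d in {0,1}, -1 <= t <= 1, in the given qubit order.\<close>
definition basic_gates :: "cmat4 set" where
  "basic_gates = {mexp (- (t *\<^sub>R (ket_bra (qidx 1 d) (qidx 0 d) - ket_bra (qidx 0 d) (qidx 1 d))))
                   | t d. d \<in> {0,1} \<and> -1 \<le> t \<and> t \<le> 1}
               \<union> {mexp (- (t *\<^sub>R cscale \<i> (ket_bra (qidx 1 d) (qidx 0 d) + ket_bra (qidx 0 d) (qidx 1 d))))
                   | t d. d \<in> {0,1} \<and> -1 \<le> t \<and> t \<le> 1}"

text \<open>Gate set: basic gates applied in either qubit order (other order = conjugation by SWAP).\<close>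
definition gate_set :: "cmat4 set" where
  "gate_set = basic_gates \<union> {SWAP ** G ** SWAP | G. G \<in> basic_gates}"

end

theory Submission
  imports Defs
begin

(* The six generators are the real and imaginary off-diagonal generators of the coordinate
   planes (0, 2), (1, 3) and (2, 3). Their brackets give those of the planes (0, 3), (1, 2),
   (0, 1) and three diagonal elements: fifteen matrices spanning su(4).

   The basic gates are rotations R_y(t), R_x(t) of the planes (|0d>, |1d>), i.e. SU(2) matrices
   acting on two coordinates. They form one-parameter groups, so |t| <= 1 is no restriction.
   Conjugating R_x by R_y(pi/4) gives the diagonal phases, and the Euler decomposition
   D(u) R_y(b) D(v) then yields every SU(2) acting on these planes; conjugation by SWAP and by a
   rotation of the plane (2, 3) reaches all six coordinate planes. Finally, Givens elimination:
   right multiplication by such two-level unitaries clears a row of a matrix in SU(4) off the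
   diagonal and makes its diagonal entry nonnegative, whereupon unitarity makes the row and column
   unit vectors; after three rows the determinant forces the last diagonal entry to be 1. *)

section \<open>Indices and conjugate transposes\<close>

lemma UNIV_4_from_0: "(UNIV :: 4 set) = {0, 1, 2, 3}"
proof -
  have "x \<in> {0, 1, 2, 3}" for x :: 4
    using exhaust_4[of x] by auto
  then show ?thesis by blast
qed

lemma sum_4_from_0: "sum f (UNIV :: 4 set) = f 0 + f 1 + f 2 + f 3"
proof -
  have "(4::4) = 0" by simp
  then show ?thesis
    using sum_4[of f] by (simp only: ac_simps)
qed

lemma forall_4_from_0: "(\<forall>i :: 4. P i) \<longleftrightarrow> P 0 \<and> P 1 \<and> P 2 \<and> P 3"
  by (metis UNIV_4_from_0 UNIV_I empty_iff insertE)

lemma conj_transpose_add: "conj_transpose (A + B) = conj_transpose A + conj_transpose B"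
  by (simp add: vec_eq_iff conj_transpose_def)

lemma conj_transpose_scaleR: "conj_transpose (r *\<^sub>R A) = r *\<^sub>R conj_transpose A"
  by (simp add: vec_eq_iff conj_transpose_def)

lemma conj_transpose_mult: "conj_transpose (A ** B) = conj_transpose B ** conj_transpose A"
  by (simp add: vec_eq_iff conj_transpose_def matrix_matrix_mult_def mult.commute)

lemma conj_transpose_commutator:
  "conj_transpose (commutator A B) = commutator (conj_transpose B) (conj_transpose A)"
  by (simp add: commutator_def vec_eq_iff conj_transpose_def matrix_matrix_mult_def
      mult.commute sum_subtractf)

section \<open>The Lie algebra generated by the six generators\<close>

lemma su4_add: "A \<in> su4 \<Longrightarrow> B \<in> su4 \<Longrightarrow> A + B \<in> su4"
  by (simp add: su4_def conj_transpose_add trace_add)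

lemma su4_scaleR: "A \<in> su4 \<Longrightarrow> r *\<^sub>R A \<in> su4"
  by (simp add: su4_def conj_transpose_scaleR trace_def scaleR_sum_right[symmetric])

lemma zero_in_su4: "0 \<in> su4"
  by (simp add: su4_def vec_eq_iff conj_transpose_def trace_def)

lemma su4_commutator: "A \<in> su4 \<Longrightarrow> B \<in> su4 \<Longrightarrow> commutator A B \<in> su4"
proof -
  assume "A \<in> su4" "B \<in> su4"
  have neg_mult_neg: "(- X) ** (- Y) = X ** Y" for X Y :: cmat4
    by (simp add: vec_eq_iff matrix_matrix_mult_def sum_negf[symmetric])
  have "conj_transpose (commutator A B) = commutator (- B) (- A)"
    using \<open>A \<in> su4\<close> \<open>B \<in> su4\<close> by (simp add: su4_def conj_transpose_commutator)
  also have "\<dots> = - commutator A B"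
    by (simp add: commutator_def neg_mult_neg)
  moreover have "trace (commutator A B) = 0"
    by (simp add: commutator_def trace_sub trace_mul_sym[of A B])
  ultimately show ?thesis by (simp add: su4_def)
qed

lemma real_lie_gen_subset_su4:
  assumes "S \<subseteq> su4"
  shows "real_lie_gen S \<subseteq> su4"
proof
  fix A assume "A \<in> real_lie_gen S"
  then show "A \<in> su4"
    by induction (use assms in \<open>auto intro: zero_in_su4 su4_add su4_scaleR su4_commutator\<close>)
qed

definition asym_gen :: "4 \<Rightarrow> 4 \<Rightarrow> cmat4" where
  "asym_gen i j = ket_bra j i - ket_bra i j"

definition sym_gen :: "4 \<Rightarrow> 4 \<Rightarrow> cmat4" where
  "sym_gen i j = cscale \<i> (ket_bra j i + ket_bra i j)"

definition diag_gen :: "4 \<Rightarrow> 4 \<Rightarrow> cmat4" where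
  "diag_gen i j = cscale \<i> (ket_bra i i - ket_bra j j)"

lemma generators_eq:
  "gU = asym_gen 1 3" "gY = sym_gen 1 3" "gT = asym_gen 2 3"
  "gX = sym_gen 2 3" "gV = asym_gen 0 2" "gZ = sym_gen 0 2"
  by (simp_all add: gU_def gY_def gT_def gX_def gV_def gZ_def asym_gen_def sym_gen_def)

lemma su4_expansion:
  assumes "A \<in> su4"
  shows "A = (- Re (A$0$1)) *\<^sub>R asym_gen 0 1 + Im (A$0$1) *\<^sub>R sym_gen 0 1
     + (- Re (A$0$2)) *\<^sub>R asym_gen 0 2 + Im (A$0$2) *\<^sub>R sym_gen 0 2
     + (- Re (A$0$3)) *\<^sub>R asym_gen 0 3 + Im (A$0$3) *\<^sub>R sym_gen 0 3
     + (- Re (A$1$2)) *\<^sub>R asym_gen 1 2 + Im (A$1$2) *\<^sub>R sym_gen 1 2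
     + (- Re (A$1$3)) *\<^sub>R asym_gen 1 3 + Im (A$1$3) *\<^sub>R sym_gen 1 3
     + (- Re (A$2$3)) *\<^sub>R asym_gen 2 3 + Im (A$2$3) *\<^sub>R sym_gen 2 3
     + Im (A$0$0) *\<^sub>R diag_gen 0 1 + (Im (A$0$0) + Im (A$1$1)) *\<^sub>R diag_gen 1 2
     + (Im (A$0$0) + Im (A$1$1) + Im (A$2$2)) *\<^sub>R diag_gen 2 3"
proof -
  have anti: "A$i$j = - cnj (A$j$i)" for i j
  proof -
    have "conj_transpose A $ j $ i = - A $ j $ i"
      using assms by (simp add: su4_def)
    then show ?thesis
      by (simp add: conj_transpose_def) (metis complex_cnj_cnj complex_cnj_minus)
  qed
  have diag: "Re (A$k$k) = 0" for k
    using anti[of k k] by (simp add: complex_eq_iff)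
  have last: "A$3$3 = - (A$0$0 + A$1$1 + A$2$2)"
  proof -
    have "A$0$0 + A$1$1 + A$2$2 + A$3$3 = 0"
      using assms by (simp add: su4_def trace_def sum_4_from_0)
    then show ?thesis
      by (simp add: algebra_simps eq_neg_iff_add_eq_0)
  qed
  show ?thesis
    using diag[of 0] diag[of 1] diag[of 2]
    by (simp add: vec_eq_iff forall_4_from_0 asym_gen_def sym_gen_def diag_gen_def ket_bra_def
        cscale_def complex_eq_iff anti[of 1 0] anti[of 2 0] anti[of 3 0] anti[of 2 1]
        anti[of 3 1] anti[of 3 2] last)
qed

lemmas matrix_entry_simps = vec_eq_iff forall_4_from_0 sum_4_from_0 matrix_matrix_mult_def
  commutator_def ket_bra_def cscale_def asym_gen_def sym_gen_def diag_gen_def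

lemma commutator_table:
  "asym_gen 0 3 = commutator (asym_gen 2 3) (asym_gen 0 2)"
  "sym_gen 0 3 = commutator (asym_gen 2 3) (sym_gen 0 2)"
  "asym_gen 1 2 = commutator (asym_gen 1 3) (asym_gen 2 3)"
  "sym_gen 1 2 = commutator (sym_gen 2 3) (asym_gen 1 3)"
  "asym_gen 0 1 = commutator (asym_gen 0 3) (asym_gen 1 3)"
  "sym_gen 0 1 = commutator (sym_gen 0 3) (asym_gen 1 3)"
  "diag_gen 0 1 = (1/2::real) *\<^sub>R commutator (sym_gen 0 1) (asym_gen 0 1)"
  "diag_gen 1 2 = (1/2::real) *\<^sub>R commutator (sym_gen 1 2) (asym_gen 1 2)"
  "diag_gen 2 3 = (1/2::real) *\<^sub>R commutator (sym_gen 2 3) (asym_gen 2 3)"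
  by (simp_all add: matrix_entry_simps)

lemma su4_subset_real_lie_gen: "su4 \<subseteq> real_lie_gen {gU, gY, gT, gX, gV, gZ}"
proof
  let ?L = "real_lie_gen {gU, gY, gT, gX, gV, gZ}"
  note closed = real_lie_gen.bracket real_lie_gen.scale
  have "asym_gen 1 3 \<in> ?L" "sym_gen 1 3 \<in> ?L" "asym_gen 2 3 \<in> ?L"
    "sym_gen 2 3 \<in> ?L" "asym_gen 0 2 \<in> ?L" "sym_gen 0 2 \<in> ?L"
    by (simp_all add: real_lie_gen.gen flip: generators_eq)
  moreover from this have "asym_gen 0 3 \<in> ?L" "sym_gen 0 3 \<in> ?L"
    "asym_gen 1 2 \<in> ?L" "sym_gen 1 2 \<in> ?L"
    unfolding commutator_table by (simp_all add: closed)
  moreover from calculation have "asym_gen 0 1 \<in> ?L" "sym_gen 0 1 \<in> ?L"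
    unfolding commutator_table(5,6) by (simp_all add: closed)
  moreover from calculation have "diag_gen 0 1 \<in> ?L" "diag_gen 1 2 \<in> ?L" "diag_gen 2 3 \<in> ?L"
    unfolding commutator_table(7-9) by (simp_all add: closed)
  ultimately show "A \<in> ?L" if "A \<in> su4" for A
    by (subst su4_expansion[OF that]) (intro real_lie_gen.add real_lie_gen.scale; assumption)
qed

theorem real_lie_gen_generators_eq_su4: "real_lie_gen {gU, gY, gT, gX, gV, gZ} = su4"
proof
  show "real_lie_gen {gU, gY, gT, gX, gV, gZ} \<subseteq> su4"
    by (rule real_lie_gen_subset_su4)
       (simp add: su4_def generators_eq matrix_entry_simps conj_transpose_def trace_def)
qed (rule su4_subset_real_lie_gen)

section \<open>Two-level special unitaries\<close>

definition unitary :: "cmat4 \<Rightarrow> bool" where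
  "unitary A \<longleftrightarrow> A ** conj_transpose A = mat 1"

lemma SU4_iff: "A \<in> SU4 \<longleftrightarrow> unitary A \<and> det A = 1"
  by (simp add: SU4_def unitary_def)

lemma unitary_mult: "unitary A \<Longrightarrow> unitary B \<Longrightarrow> unitary (A ** B)"
proof -
  assume "unitary A" "unitary B"
  have "(A ** B) ** conj_transpose (A ** B) = A ** (B ** conj_transpose B) ** conj_transpose A"
    by (simp add: conj_transpose_mult matrix_mul_assoc)
  then show ?thesis
    using \<open>unitary A\<close> \<open>unitary B\<close> by (simp add: unitary_def)
qed

lemma SU4_mult: "A \<in> SU4 \<Longrightarrow> B \<in> SU4 \<Longrightarrow> A ** B \<in> SU4"
  by (simp add: SU4_iff unitary_mult det_mul)

lemma conj_transpose_mat_1: "conj_transpose (mat 1) = mat 1"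
  by (simp add: vec_eq_iff conj_transpose_def mat_def)

lemma mat_1_in_SU4: "mat 1 \<in> SU4"
  by (simp add: SU4_def conj_transpose_mat_1 det_I)

lemma unitary_rows_orthonormal:
  "unitary B \<Longrightarrow> (\<Sum>k\<in>UNIV. B$i$k * cnj (B$j$k)) = (if i = j then 1 else 0)"
  unfolding unitary_def
  by (drule arg_cong[where f = "\<lambda>M. M $ i $ j"]) (simp add: matrix_matrix_mult_def conj_transpose_def mat_def)

lemma sum_mult_cnj_eq_1: "cmod a ^ 2 + cmod b ^ 2 = 1 \<Longrightarrow> a * cnj a + b * cnj b = 1"
  by (metis complex_norm_square of_real_1 of_real_add)

definition su2_embed :: "4 \<Rightarrow> 4 \<Rightarrow> complex \<Rightarrow> complex \<Rightarrow> cmat4" where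
  "su2_embed p q a b = (\<chi> i j.
     if i = p \<and> j = p then a else if i = p \<and> j = q then - cnj b
     else if i = q \<and> j = p then b else if i = q \<and> j = q then cnj a
     else if i = j then 1 else 0)"

lemma cmat4_eqI: "(\<And>i j. A$i$j = B$i$j) \<Longrightarrow> (A :: cmat4) = B"
  by (simp add: vec_eq_iff)

lemma sum_two_terms:
  fixes f :: "4 \<Rightarrow> complex"
  assumes "p \<noteq> q"
  shows "(\<Sum>k\<in>UNIV. f k * (if k = p then a else if k = q then b else 0)) = f p * a + f q * b"
proof -
  have "(\<Sum>k\<in>UNIV. f k * (if k = p then a else if k = q then b else 0)) =
        (\<Sum>k\<in>UNIV. (if k = p then f p * a else 0) + (if k = q then f q * b else 0))"
    by (rule sum.cong) (use assms in auto)
  also have "\<dots> = f p * a + f q * b"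
    by (simp add: sum.distrib)
  finally show ?thesis .
qed

lemma matrix_mult_su2_embed:
  assumes "p \<noteq> q"
  shows "(A ** su2_embed p q a b)$i$j =
    (if j = p then A$i$p * a + A$i$q * b
     else if j = q then A$i$q * cnj a - A$i$p * cnj b else A$i$j)"
proof -
  have prod: "(A ** su2_embed p q a b)$i$j = (\<Sum>k\<in>UNIV. A$i$k * su2_embed p q a b $k$j)"
    by (simp add: matrix_matrix_mult_def)
  consider "j = p" | "j = q" | "j \<noteq> p" "j \<noteq> q" by blast
  then show ?thesis
  proof cases
    case 1
    have "(A ** su2_embed p q a b)$i$j
        = (\<Sum>k\<in>UNIV. A$i$k * (if k = p then a else if k = q then b else 0))"
      unfolding prod using 1 assms by (intro sum.cong) (auto simp: su2_embed_def)
    then show ?thesis using 1 assms sum_two_terms by simp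
  next
    case 2
    have "(A ** su2_embed p q a b)$i$j
        = (\<Sum>k\<in>UNIV. A$i$k * (if k = q then cnj a else if k = p then - cnj b else 0))"
      unfolding prod using 2 assms by (intro sum.cong) (auto simp: su2_embed_def)
    then show ?thesis using 2 assms sum_two_terms[of q p] by simp
  next
    case 3
    have "(A ** su2_embed p q a b)$i$j = (\<Sum>k\<in>UNIV. if k = j then A$i$k else 0)"
      unfolding prod using 3 by (intro sum.cong) (auto simp: su2_embed_def)
    then show ?thesis using 3 by simp
  qed
qed

lemma su2_embed_mult:
  assumes "p \<noteq> q"
  shows "su2_embed p q a b ** su2_embed p q c d = su2_embed p q (a*c - cnj b * d) (b*c + cnj a * d)"
  unfolding vec_eq_iff matrix_mult_su2_embed[OF assms]
  using assms by (auto simp: su2_embed_def algebra_simps)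

lemma conj_transpose_su2_embed: "conj_transpose (su2_embed p q a b) = su2_embed p q (cnj a) (- b)"
proof (rule cmat4_eqI)
  fix i j
  show "(conj_transpose (su2_embed p q a b)) $ i $ j = (su2_embed p q (cnj a) (- b)) $ i $ j"
    by (cases "i = p"; cases "i = q"; cases "j = p"; cases "j = q")
       (simp_all add: conj_transpose_def su2_embed_def)
qed

lemma su2_embed_1_0: "su2_embed p q 1 0 = mat 1"
proof (rule cmat4_eqI)
  fix i j
  show "(su2_embed p q 1 0) $ i $ j = (mat 1) $ i $ j"
    by (cases "i = p"; cases "i = q"; cases "j = p"; cases "j = q")
       (simp_all add: mat_def su2_embed_def)
qed

lemma su2_embed_swap_indices:
  "p \<noteq> q \<Longrightarrow> su2_embed q p a b = su2_embed p q (cnj a) (- cnj b)"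
  by (auto simp: vec_eq_iff su2_embed_def)

lemma unitary_su2_embed:
  assumes "p \<noteq> q" "cmod a ^ 2 + cmod b ^ 2 = 1"
  shows "unitary (su2_embed p q a b)"
proof -
  have "a * cnj a - cnj b * - b = 1"
    using sum_mult_cnj_eq_1[OF assms(2)] by (simp add: algebra_simps)
  then show ?thesis
    by (simp add: unitary_def conj_transpose_su2_embed su2_embed_mult[OF assms(1)] su2_embed_1_0)
qed

lemma det_su2_embed_nonzero:
  assumes pq: "p \<noteq> q" and a: "a \<noteq> 0"
  shows "det (su2_embed p q a b) = a * cnj a + b * cnj b"
proof -
  let ?E = "su2_embed p q a b"
  define M :: cmat4 where
    "M = (\<chi> i j. if i = q then (if j = q then (a * cnj a + b * cnj b) / a else 0) else ?E$i$j)"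
  \<comment> \<open>Subtracting \<open>b/a\<close> times row \<open>p\<close> from row \<open>q\<close> makes the matrix triangular.\<close>
  have "M = (\<chi> k. if k = q then row q ?E + (- b / a) *s row p ?E else row k ?E)"
    using pq a by (auto simp: vec_eq_iff M_def row_def su2_embed_def field_simps)
  then have "det M = det ?E"
    using det_row_operation[OF pq[symmetric]] by simp
  moreover have "det M = prod (\<lambda>i. M$i$i) UNIV"
  proof (cases "p < q")
    case True
    then show ?thesis
      by (intro det_upperdiagonal) (use pq in \<open>auto simp: M_def su2_embed_def\<close>)
  next
    case False
    then show ?thesis
      by (intro det_lowerdiagonal) (use pq in \<open>auto simp: M_def su2_embed_def\<close>)
  qed
  moreover have "M$i$i = (if i = p then a else 1) * (if i = q then (a * cnj a + b * cnj b) / a else 1)"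
    for i
    using pq by (auto simp: M_def su2_embed_def)
  then have "prod (\<lambda>i. M$i$i) UNIV = a * cnj a + b * cnj b"
    using a by (simp add: prod.distrib)
  ultimately show ?thesis
    by simp
qed

lemma det_su2_embed:
  assumes pq: "p \<noteq> q" and n: "cmod a ^ 2 + cmod b ^ 2 = 1"
  shows "det (su2_embed p q a b) = 1"
proof (cases "a = 0")
  case False
  then show ?thesis
    using det_su2_embed_nonzero[OF pq] sum_mult_cnj_eq_1[OF n] by simp
next
  case True
  \<comment> \<open>Then the matrix is the square of one with diagonal entry \<open>1/\<surd>2\<close>.\<close>
  define h :: complex where "h = of_real (1 / sqrt 2)"
  have "1 / sqrt 2 * (1 / sqrt 2) = (1 / 2 :: real)"
    by simp
  then have hh: "h * h = 1 / 2"
    unfolding h_def by (metis of_real_mult of_real_divide of_real_1 of_real_numeral)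
  have h: "cnj h = h" "h \<noteq> 0"
    by (simp_all add: h_def)
  have bb: "cnj b * b = 1"
    using sum_mult_cnj_eq_1[OF n] True by (simp add: mult.commute)
  have cnj_bh: "cnj (b * h) * (b * h) = (cnj b * b) * (h * h)"
    unfolding h_def by (simp add: mult_ac)
  have "h * h - cnj (b * h) * (b * h) = a"
    unfolding cnj_bh bb True by simp
  moreover have "b * h * h + cnj h * (b * h) = b * (2 * (h * h))"
    unfolding h_def by (simp add: algebra_simps)
  then have "b * h * h + cnj h * (b * h) = b"
    by (simp add: hh)
  ultimately have "su2_embed p q h (b * h) ** su2_embed p q h (b * h) = su2_embed p q a b"
    by (simp add: su2_embed_mult[OF pq])
  then have "det (su2_embed p q a b) = det (su2_embed p q h (b * h)) ^ 2"
    by (metis det_mul power2_eq_square)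
  also have "det (su2_embed p q h (b * h)) = h * h + (cnj b * b) * (h * h)"
    using det_su2_embed_nonzero[OF pq h(2)] unfolding h_def by (simp add: mult_ac)
  finally show ?thesis
    by (simp add: hh bb)
qed

section \<open>Exponentials of planar generators\<close>

definition plane_gen :: "4 \<Rightarrow> 4 \<Rightarrow> complex \<Rightarrow> cmat4" where
  "plane_gen p q z = (\<chi> i j. if i = q \<and> j = p then z else if i = p \<and> j = q then - cnj z else 0)"

lemma plane_gen_mult:
  assumes pq: "p \<noteq> q"
  shows "(plane_gen p q z ** A)$i$j =
    (if i = q then z * A$p$j else if i = p then - cnj z * A$q$j else 0)"
proof -
  have prod: "(plane_gen p q z ** A)$i$j = (\<Sum>k\<in>UNIV. plane_gen p q z $i$k * A$k$j)"
    by (simp add: matrix_matrix_mult_def)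
  consider "i = q" | "i = p" | "i \<noteq> p" "i \<noteq> q"
    by blast
  then show ?thesis
  proof cases
    case 1
    have "(plane_gen p q z ** A)$i$j = (\<Sum>k\<in>UNIV. if k = p then z * A$p$j else 0)"
      unfolding prod using 1 pq by (intro sum.cong) (auto simp: plane_gen_def)
    then show ?thesis
      using 1 by simp
  next
    case 2
    have "(plane_gen p q z ** A)$i$j = (\<Sum>k\<in>UNIV. if k = q then - cnj z * A$q$j else 0)"
      unfolding prod using 2 pq by (intro sum.cong) (auto simp: plane_gen_def)
    then show ?thesis
      using 2 pq by simp
  next
    case 3
    then show ?thesis
      unfolding prod by (simp add: plane_gen_def)
  qed
qed

lemma mpow_plane_gen:
  assumes pq: "p \<noteq> q" and w: "cnj w * w = 1"
  shows "mpow (plane_gen p q (of_real s * w)) n $ i $ j =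
    (if (i = p \<and> j = p) \<or> (i = q \<and> j = q) then of_real (Re ((\<i> * of_real s) ^ n))
     else if i = q \<and> j = p then w * of_real (Im ((\<i> * of_real s) ^ n))
     else if i = p \<and> j = q then - cnj w * of_real (Im ((\<i> * of_real s) ^ n))
     else if i = j \<and> n = 0 then 1 else 0)"
proof (induction n arbitrary: i j)
  case 0
  show ?case
    using pq by (auto simp: mat_def)
next
  case (Suc n)
  have Re_Suc: "Re ((\<i> * of_real s) ^ Suc n) = - s * Im ((\<i> * of_real s) ^ n)"
    and Im_Suc: "Im ((\<i> * of_real s) ^ Suc n) = s * Re ((\<i> * of_real s) ^ n)"
    by simp_all
  have w': "w * cnj w = 1"
    using w by (simp add: mult.commute)
  show ?case
    unfolding mpow.simps plane_gen_mult[OF pq] Suc.IH Re_Suc Im_Suc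
    using pq by (auto simp: algebra_simps w w')
qed

lemma sums_Re_Im_powers:
  "(\<lambda>n. of_real (Re ((\<i> * of_real s) ^ n)) / of_nat (fact n)) sums (of_real (cos s) :: complex)"
  "(\<lambda>n. of_real (Im ((\<i> * of_real s) ^ n)) / of_nat (fact n)) sums (of_real (sin s) :: complex)"
proof -
  have exp: "(\<lambda>n. (\<i> * of_real s) ^ n /\<^sub>R fact n) sums exp (\<i> * of_real s)"
    by (rule exp_converges)
  have "(\<lambda>n. Re ((\<i> * of_real s) ^ n) / fact n) sums cos s"
    using sums_Re[OF exp] by (simp add: Re_exp divide_inverse mult.commute)
  from sums_of_real[OF this, where 'a = complex]
  show "(\<lambda>n. of_real (Re ((\<i> * of_real s) ^ n)) / of_nat (fact n)) sums (of_real (cos s) :: complex)"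
    by simp
  have "(\<lambda>n. Im ((\<i> * of_real s) ^ n) / fact n) sums sin s"
    using sums_Im[OF exp] by (simp add: Im_exp divide_inverse mult.commute)
  from sums_of_real[OF this, where 'a = complex]
  show "(\<lambda>n. of_real (Im ((\<i> * of_real s) ^ n)) / of_nat (fact n)) sums (of_real (sin s) :: complex)"
    by simp
qed

lemma mexp_plane_gen:
  assumes pq: "p \<noteq> q" and w: "cnj w * w = 1"
  shows "mexp (plane_gen p q (of_real s * w)) = su2_embed p q (cos s) (w * sin s)"
proof (rule cmat4_eqI)
  fix i j
  define f where "f = (\<lambda>n. mpow (plane_gen p q (of_real s * w)) n $ i $ j / of_nat (fact n))"
  note entry = mpow_plane_gen[OF pq w]
  have "f sums (su2_embed p q (cos s) (w * sin s) $ i $ j)"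
  proof -
    consider "i = p" "j = p" | "i = q" "j = q" | "i = q" "j = p" | "i = p" "j = q"
      | "i = j" "i \<noteq> p" "i \<noteq> q" | "i \<noteq> j" "\<not> (i = q \<and> j = p)" "\<not> (i = p \<and> j = q)"
      by blast
    then show ?thesis
    proof cases
      case 1
      then have "f = (\<lambda>n. of_real (Re ((\<i> * of_real s) ^ n)) / of_nat (fact n))"
        "su2_embed p q (cos s) (w * sin s) $ i $ j = of_real (cos s)"
        by (simp_all add: f_def entry su2_embed_def)
      then show ?thesis
        using sums_Re_Im_powers(1)[of s] by (simp only:)
    next
      case 2
      then have "f = (\<lambda>n. of_real (Re ((\<i> * of_real s) ^ n)) / of_nat (fact n))"
        "su2_embed p q (cos s) (w * sin s) $ i $ j = of_real (cos s)"
        using pq by (simp_all add: f_def entry su2_embed_def)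
      then show ?thesis
        using sums_Re_Im_powers(1)[of s] by (simp only:)
    next
      case 3
      then have "f = (\<lambda>n. w * (of_real (Im ((\<i> * of_real s) ^ n)) / of_nat (fact n)))"
        "su2_embed p q (cos s) (w * sin s) $ i $ j = w * of_real (sin s)"
        using pq by (simp_all add: f_def entry su2_embed_def)
      then show ?thesis
        using sums_mult[OF sums_Re_Im_powers(2)[of s], of w] by (simp only:)
    next
      case 4
      then have "f = (\<lambda>n. - cnj w * (of_real (Im ((\<i> * of_real s) ^ n)) / of_nat (fact n)))"
        "su2_embed p q (cos s) (w * sin s) $ i $ j = - cnj w * of_real (sin s)"
        using pq by (simp_all add: f_def entry su2_embed_def)
      then show ?thesis
        using sums_mult[OF sums_Re_Im_powers(2)[of s], of "- cnj w"] by (simp only:)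
    next
      case 5
      then have "f = (\<lambda>n. if n = 0 then 1 else 0)" "su2_embed p q (cos s) (w * sin s) $ i $ j = 1"
        by (simp_all add: fun_eq_iff f_def entry su2_embed_def)
      then show ?thesis
        using sums_single[of 0 "\<lambda>_. 1 :: complex"] by simp
    next
      case 6
      then have "f = (\<lambda>n. 0)" "su2_embed p q (cos s) (w * sin s) $ i $ j = 0"
        using pq by (cases "i = p"; cases "j = p"; cases "i = q";
            simp add: fun_eq_iff f_def entry su2_embed_def)+
      then show ?thesis
        by simp
    qed
  qed
  then show "mexp (plane_gen p q (of_real s * w)) $ i $ j = su2_embed p q (cos s) (w * sin s) $ i $ j"
    by (simp add: mexp_def sums_iff f_def)
qed

definition ry_gate :: "4 \<Rightarrow> 4 \<Rightarrow> real \<Rightarrow> cmat4" where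
  "ry_gate p q t = su2_embed p q (cos t) (- sin t)"

definition rx_gate :: "4 \<Rightarrow> 4 \<Rightarrow> real \<Rightarrow> cmat4" where
  "rx_gate p q t = su2_embed p q (cos t) (- \<i> * sin t)"

lemma mexp_eq_ry_gate:
  assumes "p \<noteq> q"
  shows "mexp (- (t *\<^sub>R (ket_bra q p - ket_bra p q))) = ry_gate p q t"
proof -
  have "- (t *\<^sub>R (ket_bra q p - ket_bra p q)) = plane_gen p q (of_real (- t) * 1)"
    using assms by (auto simp: vec_eq_iff plane_gen_def ket_bra_def scaleR_conv_of_real[where 'a = complex])
  then show ?thesis
    using mexp_plane_gen[OF assms, of 1 "- t"] by (simp add: ry_gate_def)
qed

lemma mexp_eq_rx_gate:
  assumes "p \<noteq> q"
  shows "mexp (- (t *\<^sub>R cscale \<i> (ket_bra q p + ket_bra p q))) = rx_gate p q t"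
proof -
  have "- (t *\<^sub>R cscale \<i> (ket_bra q p + ket_bra p q)) = plane_gen p q (of_real (- t) * \<i>)"
    using assms by (auto simp: vec_eq_iff plane_gen_def ket_bra_def cscale_def scaleR_conv_of_real[where 'a = complex])
  then show ?thesis
    using mexp_plane_gen[OF assms, of \<i> "- t"] by (simp add: rx_gate_def)
qed

lemma ry_gate_add: "p \<noteq> q \<Longrightarrow> ry_gate p q (s + t) = ry_gate p q s ** ry_gate p q t"
  by (simp add: ry_gate_def su2_embed_mult cos_add sin_add algebra_simps)

lemma rx_gate_add: "p \<noteq> q \<Longrightarrow> rx_gate p q (s + t) = rx_gate p q s ** rx_gate p q t"
  by (simp add: rx_gate_def su2_embed_mult cos_add sin_add algebra_simps)

lemma qidx_neq: "d \<in> {0, 1} \<Longrightarrow> qidx 0 d \<noteq> qidx 1 d"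
  by (auto simp: qidx_def)

lemma ry_gate_in_basic_gates:
  assumes "d \<in> {0, 1}" "\<bar>t\<bar> \<le> 1"
  shows "ry_gate (qidx 0 d) (qidx 1 d) t \<in> basic_gates"
proof -
  have "mexp (- (t *\<^sub>R (ket_bra (qidx 1 d) (qidx 0 d) - ket_bra (qidx 0 d) (qidx 1 d))))
      \<in> basic_gates"
    unfolding basic_gates_def using assms
    by (intro UnI1 CollectI exI[of _ t] exI[of _ d] conjI refl) auto
  then show ?thesis
    using mexp_eq_ry_gate[OF qidx_neq[OF assms(1)]] by simp
qed

lemma rx_gate_in_basic_gates:
  assumes "d \<in> {0, 1}" "\<bar>t\<bar> \<le> 1"
  shows "rx_gate (qidx 0 d) (qidx 1 d) t \<in> basic_gates"
proof -
  have "mexp (- (t *\<^sub>R cscale \<i> (ket_bra (qidx 1 d) (qidx 0 d) + ket_bra (qidx 0 d) (qidx 1 d))))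
      \<in> basic_gates"
    unfolding basic_gates_def using assms
    by (intro UnI2 CollectI exI[of _ t] exI[of _ d] conjI refl) auto
  then show ?thesis
    using mexp_eq_rx_gate[OF qidx_neq[OF assms(1)]] by simp
qed

section \<open>Products of gates\<close>

inductive_set mat_products :: "cmat4 set \<Rightarrow> cmat4 set" for S where
  one: "mat 1 \<in> mat_products S"
| mult: "A \<in> S \<Longrightarrow> B \<in> mat_products S \<Longrightarrow> A ** B \<in> mat_products S"

lemma mat_products_eq_foldr:
  "A \<in> mat_products S \<longleftrightarrow> (\<exists>gs. set gs \<subseteq> S \<and> A = foldr (**) gs (mat 1))"
proof
  assume "A \<in> mat_products S"
  then show "\<exists>gs. set gs \<subseteq> S \<and> A = foldr (**) gs (mat 1)"
  proof induction
    case one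
    show ?case
      by (intro exI[of _ "[]"]) simp
  next
    case (mult A B)
    then obtain gs where "set gs \<subseteq> S" "B = foldr (**) gs (mat 1)"
      by blast
    with mult.hyps(1) show ?case
      by (intro exI[of _ "A # gs"]) simp
  qed
next
  assume "\<exists>gs. set gs \<subseteq> S \<and> A = foldr (**) gs (mat 1)"
  then obtain gs where "set gs \<subseteq> S" "A = foldr (**) gs (mat 1)"
    by blast
  then show "A \<in> mat_products S"
    by (induction gs arbitrary: A) (auto intro: mat_products.intros)
qed

lemma in_mat_products: "A \<in> S \<Longrightarrow> A \<in> mat_products S"
  using mat_products.mult[OF _ mat_products.one] by simp

lemma mat_products_mult:
  assumes "A \<in> mat_products S" "B \<in> mat_products S"
  shows "A ** B \<in> mat_products S"
  using assms
  by induction (auto simp flip: matrix_mul_assoc intro: mat_products.mult)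

lemma mat_products_subset:
  assumes "S \<subseteq> mat_products T"
  shows "mat_products S \<subseteq> mat_products T"
proof
  fix A assume "A \<in> mat_products S"
  then show "A \<in> mat_products T"
    by induction (use assms in \<open>auto intro: mat_products.one mat_products_mult\<close>)
qed

lemma mat_products_SU4: "S \<subseteq> SU4 \<Longrightarrow> mat_products S \<subseteq> SU4"
proof
  fix A assume "S \<subseteq> SU4" "A \<in> mat_products S"
  from \<open>A \<in> mat_products S\<close> show "A \<in> SU4"
    by induction (use \<open>S \<subseteq> SU4\<close> in \<open>auto intro: mat_1_in_SU4 SU4_mult\<close>)
qed

lemma conj_transpose_mat_products:
  assumes "\<And>A. A \<in> S \<Longrightarrow> conj_transpose A \<in> S" "A \<in> mat_products S"
  shows "conj_transpose A \<in> mat_products S"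
  using assms(2)
proof induction
  case one
  show ?case
    by (simp add: conj_transpose_mat_1 mat_products.one)
next
  case (mult A B)
  then show ?case
    by (simp add: conj_transpose_mult mat_products_mult in_mat_products assms(1))
qed

lemma one_parameter_group_in_mat_products:
  fixes G :: "real \<Rightarrow> cmat4"
  assumes add: "\<And>s t. G (s + t) = G s ** G t" and small: "\<And>t. \<bar>t\<bar> \<le> 1 \<Longrightarrow> G t \<in> S"
  shows "G t \<in> mat_products S"
proof -
  have multiple: "G (real (Suc n) * s) \<in> mat_products S" if "\<bar>s\<bar> \<le> 1" for n s
  proof (induction n)
    case 0
    show ?case
      using small[OF that] by (simp add: in_mat_products)
  next
    case (Suc n)
    have "G (real (Suc (Suc n)) * s) = G s ** G (real (Suc n) * s)"
      using add[of s "real (Suc n) * s"] by (simp add: algebra_simps)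
    then show ?case
      using Suc small[OF that] by (simp add: mat_products.mult)
  qed
  obtain n :: nat where "\<bar>t\<bar> \<le> real n"
    using real_arch_simple by blast
  then have "t = real (Suc n) * (t / real (Suc n))" "\<bar>t / real (Suc n)\<bar> \<le> 1"
    by (simp_all add: field_simps)
  then show ?thesis
    using multiple by metis
qed

lemma ry_gate_in_mat_products:
  assumes "d \<in> {0, 1}"
  shows "ry_gate (qidx 0 d) (qidx 1 d) t \<in> mat_products basic_gates"
  using ry_gate_add[OF qidx_neq[OF assms]] ry_gate_in_basic_gates[OF assms]
  by (rule one_parameter_group_in_mat_products)

lemma rx_gate_in_mat_products:
  assumes "d \<in> {0, 1}"
  shows "rx_gate (qidx 0 d) (qidx 1 d) t \<in> mat_products basic_gates"
  using rx_gate_add[OF qidx_neq[OF assms]] rx_gate_in_basic_gates[OF assms]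
  by (rule one_parameter_group_in_mat_products)

lemma phase_eq_rotations:
  assumes "p \<noteq> q"
  shows "su2_embed p q (cis u) 0 = ry_gate p q (pi/4) ** rx_gate p q (- u) ** ry_gate p q (- (pi/4))"
proof -
  have half: "sqrt 2 / 2 * (sqrt 2 / 2 * x) = x / 2" for x :: real
    by simp
  show ?thesis
    unfolding ry_gate_def rx_gate_def su2_embed_mult[OF assms]
    by (intro arg_cong2[where f = "su2_embed p q"])
       (simp_all add: cos_45 sin_45 complex_eq_iff algebra_simps half)
qed

lemma su2_euler_decomposition:
  assumes pq: "p \<noteq> q" and n: "cmod a ^ 2 + cmod b ^ 2 = 1"
  obtains u \<beta> v where
    "su2_embed p q a b = su2_embed p q (cis u) 0 ** ry_gate p q \<beta> ** su2_embed p q (cis v) 0"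
proof -
  obtain \<beta> where \<beta>: "cmod a = cos \<beta>" "- cmod b = sin \<beta>"
    using sincos_total_2pi[of "cmod a" "- cmod b"] n by auto
  define u where "u = (Arg a - Arg b) / 2"
  define v where "v = (Arg a + Arg b) / 2"
  have uv: "u + v = Arg a" "v - u = Arg b"
    by (simp_all add: u_def v_def field_simps)
  have "su2_embed p q (cis u) 0 ** ry_gate p q \<beta>
      = su2_embed p q (cis u * cos \<beta>) (- (cis (- u) * sin \<beta>))"
    unfolding ry_gate_def su2_embed_mult[OF pq]
    by (intro arg_cong2[where f = "su2_embed p q"]) (simp_all add: cis_cnj algebra_simps)
  also have "\<dots> ** su2_embed p q (cis v) 0
      = su2_embed p q (cos \<beta> * cis (u + v)) (- (sin \<beta> * cis (v - u)))"
    unfolding su2_embed_mult[OF pq]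
    by (intro arg_cong2[where f = "su2_embed p q"])
       (simp_all add: complex_eq_iff cos_add sin_add cos_diff sin_diff algebra_simps)
  also have "\<dots> = su2_embed p q a b"
  proof -
    have "cos \<beta> * cis (u + v) = a"
      unfolding uv \<beta>(1)[symmetric] by (metis rcis_cmod_Arg rcis_def)
    moreover have "- (sin \<beta> * cis (v - u)) = of_real (cmod b) * cis (Arg b)"
      unfolding uv \<beta>(2)[symmetric] by simp
    then have "- (sin \<beta> * cis (v - u)) = b"
      by (metis rcis_cmod_Arg rcis_def)
    ultimately show ?thesis
      by simp
  qed
  finally show ?thesis
    by (rule that[OF sym])
qed

lemma su2_embed_in_mat_products_basic_gates:
  assumes "d \<in> {0, 1}" "cmod a ^ 2 + cmod b ^ 2 = 1"
  shows "su2_embed (qidx 0 d) (qidx 1 d) a b \<in> mat_products basic_gates"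
proof -
  note neq = qidx_neq[OF assms(1)]
  have phase: "su2_embed (qidx 0 d) (qidx 1 d) (cis u) 0 \<in> mat_products basic_gates" for u
    unfolding phase_eq_rotations[OF neq]
    by (intro mat_products_mult ry_gate_in_mat_products rx_gate_in_mat_products assms(1))
  obtain u \<beta> v where "su2_embed (qidx 0 d) (qidx 1 d) a b
      = su2_embed (qidx 0 d) (qidx 1 d) (cis u) 0 ** ry_gate (qidx 0 d) (qidx 1 d) \<beta>
        ** su2_embed (qidx 0 d) (qidx 1 d) (cis v) 0"
    using su2_euler_decomposition[OF neq assms(2)] .
  then show ?thesis
    by (simp only:) (intro mat_products_mult phase ry_gate_in_mat_products assms(1))
qed

section \<open>Two-level unitaries from the gate set\<close>

lemma SWAP_mult_SWAP: "SWAP ** SWAP = mat 1"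
  by (simp add: vec_eq_iff forall_4_from_0 sum_4_from_0 matrix_matrix_mult_def SWAP_def
      ket_bra_def mat_def)

lemma SWAP_conj_in_mat_products:
  assumes "A \<in> mat_products basic_gates"
  shows "SWAP ** A ** SWAP \<in> mat_products gate_set"
  using assms
proof induction
  case one
  show ?case
    by (simp add: SWAP_mult_SWAP mat_products.one)
next
  case (mult A B)
  have "SWAP ** (A ** B) ** SWAP = (SWAP ** A ** SWAP) ** (SWAP ** B ** SWAP)"
    by (metis SWAP_mult_SWAP matrix_mul_assoc matrix_mul_rid)
  moreover have "SWAP ** A ** SWAP \<in> gate_set"
    using mult.hyps(1) by (auto simp: gate_set_def)
  ultimately show ?case
    using mult.IH by (simp add: mat_products.mult)
qed

lemma SWAP_conj_su2_embed:
  "SWAP ** su2_embed 0 2 a b ** SWAP = su2_embed 0 1 a b"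
  "SWAP ** su2_embed 1 3 a b ** SWAP = su2_embed 2 3 a b"
  by (simp_all add: vec_eq_iff forall_4_from_0 sum_4_from_0 matrix_matrix_mult_def SWAP_def
      ket_bra_def su2_embed_def)

(* Conjugation by the rotation of the plane (2, 3) that maps the third basis vector to plus or
   minus the fourth moves the plane (0, 2) onto (0, 3) and the plane (1, 3) onto (1, 2). *)
lemma su2_embed_conj_transposition:
  "su2_embed 0 3 a b = su2_embed 2 3 0 1 ** su2_embed 0 2 a b ** su2_embed 2 3 0 (- 1)"
  "su2_embed 1 2 a b = su2_embed 2 3 0 (- 1) ** su2_embed 1 3 a b ** su2_embed 2 3 0 1"
  by (simp_all add: vec_eq_iff forall_4_from_0 sum_4_from_0 matrix_matrix_mult_def
      su2_embed_def)

definition two_level_SU :: "cmat4 set" where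
  "two_level_SU = {su2_embed p q a b | p q a b. p \<noteq> q \<and> cmod a ^ 2 + cmod b ^ 2 = 1}"

lemma su2_embed_in_two_level_SU:
  "p \<noteq> q \<Longrightarrow> cmod a ^ 2 + cmod b ^ 2 = 1 \<Longrightarrow> su2_embed p q a b \<in> two_level_SU"
  unfolding two_level_SU_def by blast

lemma two_level_SU_subset_SU4: "two_level_SU \<subseteq> SU4"
  by (auto simp: two_level_SU_def SU4_iff unitary_su2_embed det_su2_embed)

lemma conj_transpose_two_level_SU:
  assumes "A \<in> two_level_SU"
  shows "conj_transpose A \<in> two_level_SU"
proof -
  obtain p q a b where "A = su2_embed p q a b" "p \<noteq> q" "cmod a ^ 2 + cmod b ^ 2 = 1"
    using assms by (auto simp: two_level_SU_def)
  then show ?thesis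
    by (simp add: conj_transpose_su2_embed su2_embed_in_two_level_SU)
qed

lemma su2_embed_in_gate_products:
  assumes "cmod a ^ 2 + cmod b ^ 2 = 1"
  shows "su2_embed 0 1 a b \<in> mat_products gate_set" "su2_embed 0 2 a b \<in> mat_products gate_set"
    "su2_embed 0 3 a b \<in> mat_products gate_set" "su2_embed 1 2 a b \<in> mat_products gate_set"
    "su2_embed 1 3 a b \<in> mat_products gate_set" "su2_embed 2 3 a b \<in> mat_products gate_set"
proof -
  have basic_subset: "mat_products basic_gates \<subseteq> mat_products gate_set"
    by (rule mat_products_subset) (auto simp: gate_set_def intro: in_mat_products)
  have plane02: "su2_embed 0 2 a b \<in> mat_products basic_gates"
    and plane13: "su2_embed 1 3 a b \<in> mat_products basic_gates"
    if "cmod a ^ 2 + cmod b ^ 2 = 1" for a b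
    using su2_embed_in_mat_products_basic_gates[OF _ that, of 0]
      su2_embed_in_mat_products_basic_gates[OF _ that, of 1]
    by (simp_all add: qidx_def)
  have plane23: "su2_embed 2 3 a b \<in> mat_products gate_set"
    if "cmod a ^ 2 + cmod b ^ 2 = 1" for a b
    using SWAP_conj_in_mat_products[OF plane13[OF that]] by (simp add: SWAP_conj_su2_embed)
  have flip: "su2_embed 2 3 0 1 \<in> mat_products gate_set" "su2_embed 2 3 0 (- 1) \<in> mat_products gate_set"
    by (simp_all add: plane23)
  show "su2_embed 0 1 a b \<in> mat_products gate_set"
    using SWAP_conj_in_mat_products[OF plane02[OF assms]] by (simp add: SWAP_conj_su2_embed)
  show "su2_embed 0 2 a b \<in> mat_products gate_set" "su2_embed 1 3 a b \<in> mat_products gate_set"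
    using assms basic_subset plane02 plane13 by auto
  show "su2_embed 0 3 a b \<in> mat_products gate_set" "su2_embed 1 2 a b \<in> mat_products gate_set"
    using assms basic_subset plane02 plane13
    by (auto simp: su2_embed_conj_transposition intro!: mat_products_mult flip)
  show "su2_embed 2 3 a b \<in> mat_products gate_set"
    using assms by (rule plane23)
qed

lemma two_level_SU_subset_gates: "two_level_SU \<subseteq> mat_products gate_set"
proof
  have ordered: "su2_embed p q a b \<in> mat_products gate_set"
    if "(p, q) \<in> {(0, 1), (0, 2), (0, 3), (1, 2), (1, 3), (2, 3)}" "cmod a ^ 2 + cmod b ^ 2 = 1"
    for p q a b
    using that su2_embed_in_gate_products[OF that(2)] by auto
  fix A assume "A \<in> two_level_SU"
  then obtain p q a b where A: "A = su2_embed p q a b" "p \<noteq> q" "cmod a ^ 2 + cmod b ^ 2 = 1"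
    by (auto simp: two_level_SU_def)
  have "p \<in> {0, 1, 2, 3}" "q \<in> {0, 1, 2, 3}"
    by (simp_all only: UNIV_4_from_0[symmetric] UNIV_I)
  then consider "(p, q) \<in> {(0, 1), (0, 2), (0, 3), (1, 2), (1, 3), (2, 3)}"
    | "(q, p) \<in> {(0, 1), (0, 2), (0, 3), (1, 2), (1, 3), (2, 3)}"
    using A(2) by blast
  then show "A \<in> mat_products gate_set"
  proof cases
    case 1
    then show ?thesis
      using ordered A by simp
  next
    case 2
    then show ?thesis
      using ordered[OF 2, of "cnj a" "- cnj b"] A su2_embed_swap_indices[OF A(2)[symmetric]]
      by simp
  qed
qed

section \<open>Elimination by two-level unitaries\<close>

lemma su2_embed_clears_entry:
  assumes "p \<noteq> q"
  obtains a b r where "cmod a ^ 2 + cmod b ^ 2 = 1" "(A ** su2_embed p q a b)$i$q = 0"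
    "r \<ge> 0" "(A ** su2_embed p q a b)$i$p = of_real r"
proof -
  define x where "x = A$i$p"
  define y where "y = A$i$q"
  define r where "r = sqrt (cmod x ^ 2 + cmod y ^ 2)"
  have r_sq: "r ^ 2 = cmod x ^ 2 + cmod y ^ 2"
    by (simp add: r_def)
  show ?thesis
  proof (cases "r = 0")
    case True
    then have "x = 0" "y = 0"
      using r_sq by (simp_all add: sum_power2_eq_zero_iff)
    then show ?thesis
      using assms by (intro that[of 1 0 0]) (simp_all add: matrix_mult_su2_embed x_def y_def)
  next
    case False
    moreover have "r \<ge> 0"
      by (simp add: r_def)
    ultimately have "r > 0"
      by simp
    \<comment> \<open>The rotation maps the row \<open>(x, y)\<close> to \<open>(r, 0)\<close>.\<close>
    define a where "a = cnj x / of_real r"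
    define b where "b = cnj y / of_real r"
    have "cmod a ^ 2 + cmod b ^ 2 = (cmod x ^ 2 + cmod y ^ 2) / r ^ 2"
      by (simp add: a_def b_def norm_divide power_divide add_divide_distrib)
    also have "\<dots> = r ^ 2 / r ^ 2"
      by (simp only: r_sq)
    also have "\<dots> = 1"
      using \<open>r > 0\<close> by simp
    finally have norm: "cmod a ^ 2 + cmod b ^ 2 = 1" .
    have zero: "(A ** su2_embed p q a b)$i$q = 0"
      using assms \<open>r > 0\<close>
      by (simp add: matrix_mult_su2_embed a_def b_def flip: x_def y_def)
    have "(A ** su2_embed p q a b)$i$p = (x * cnj x + y * cnj y) / of_real r"
      using assms \<open>r > 0\<close>
      by (simp add: matrix_mult_su2_embed a_def b_def add_divide_distrib flip: x_def y_def)
    also have "\<dots> = of_real (r ^ 2) / of_real r"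
      unfolding r_sq by (simp only: of_real_add complex_norm_square)
    also have "\<dots> = of_real r"
      using \<open>r > 0\<close> by (simp add: power2_eq_square)
    finally show ?thesis
      using zero \<open>r > 0\<close> norm by (intro that[of a b r]) simp_all
  qed
qed

lemma unitary_unit_row:
  assumes "unitary B" "r \<ge> 0" "B$i$i = of_real r" "\<And>j. j \<noteq> i \<Longrightarrow> B$i$j = 0"
  shows "B$i = mat 1 $ i" "\<And>k. k \<noteq> i \<Longrightarrow> B$k$i = 0"
proof -
  have inner: "(\<Sum>j\<in>UNIV. B$k$j * cnj (B$i$j)) = B$k$i * of_real r" for k
  proof -
    have "B$k$j * cnj (B$i$j) = (if j = i then B$k$i * of_real r else 0)" for j
      using assms(3,4) by auto
    then show ?thesis
      by simp
  qed
  have "of_real (r * r) = (1 :: complex)"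
    using unitary_rows_orthonormal[OF assms(1), of i i] inner[of i] assms(3) by simp
  then have "(r - 1) * (r + 1) = 0"
    by (simp only: of_real_eq_1_iff) (simp add: algebra_simps)
  then have "r = 1"
    using assms(2) by simp
  then show "B$i = mat 1 $ i"
    using assms(3,4) by (auto simp: vec_eq_iff mat_def)
  show "B$k$i = 0" if "k \<noteq> i" for k
    using unitary_rows_orthonormal[OF assms(1), of k i] inner[of k] that \<open>r = 1\<close> by simp
qed

lemma two_level_products_clear_row:
  assumes "finite J" "J \<noteq> {}" "i \<notin> J"
  shows "\<exists>E \<in> mat_products two_level_SU.
    (\<forall>j\<in>J. (B ** E)$i$j = 0) \<and> (\<exists>r\<ge>0. (B ** E)$i$i = of_real r) \<and>
    (\<forall>k j. j \<notin> insert i J \<longrightarrow> (B ** E)$k$j = B$k$j) \<and>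
    (\<forall>k. (\<forall>j\<in>insert i J. B$k$j = 0) \<longrightarrow> (\<forall>j\<in>insert i J. (B ** E)$k$j = 0))"
  using assms
proof (induction J arbitrary: B rule: finite_ne_induct)
  case (singleton j)
  then have "i \<noteq> j"
    by simp
  obtain a b r where ab: "cmod a ^ 2 + cmod b ^ 2 = 1" "(B ** su2_embed i j a b)$i$j = 0"
    "r \<ge> 0" "(B ** su2_embed i j a b)$i$i = of_real r"
    using su2_embed_clears_entry[OF \<open>i \<noteq> j\<close>] by blast
  have "su2_embed i j a b \<in> mat_products two_level_SU"
    using \<open>i \<noteq> j\<close> ab(1) by (intro in_mat_products su2_embed_in_two_level_SU)
  then show ?case
    using ab \<open>i \<noteq> j\<close> by (intro bexI[of _ "su2_embed i j a b"]) (auto simp: matrix_mult_su2_embed)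
next
  case (insert j J)
  then have "i \<noteq> j" "i \<notin> J"
    by simp_all
  obtain E where E: "E \<in> mat_products two_level_SU" "\<forall>j\<in>J. (B ** E)$i$j = 0"
    "\<forall>k j. j \<notin> insert i J \<longrightarrow> (B ** E)$k$j = B$k$j"
    "\<forall>k. (\<forall>j\<in>insert i J. B$k$j = 0) \<longrightarrow> (\<forall>j\<in>insert i J. (B ** E)$k$j = 0)"
    using insert.IH[OF \<open>i \<notin> J\<close>] by blast
  obtain a b r where ab: "cmod a ^ 2 + cmod b ^ 2 = 1" "(B ** E ** su2_embed i j a b)$i$j = 0"
    "r \<ge> 0" "(B ** E ** su2_embed i j a b)$i$i = of_real r"
    using su2_embed_clears_entry[OF \<open>i \<noteq> j\<close>] by blast
  have "E ** su2_embed i j a b \<in> mat_products two_level_SU"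
    using \<open>i \<noteq> j\<close> ab(1)
    by (intro mat_products_mult[OF E(1)] in_mat_products su2_embed_in_two_level_SU)
  moreover have "B ** (E ** su2_embed i j a b) = B ** E ** su2_embed i j a b"
    by (simp add: matrix_mul_assoc)
  ultimately show ?case
    using ab E(2-4) \<open>i \<noteq> j\<close> \<open>j \<notin> J\<close> \<open>i \<notin> J\<close>
    by (intro bexI[of _ "E ** su2_embed i j a b"]) (auto simp: matrix_mult_su2_embed)
qed

lemma two_level_products_next_row:
  assumes "B \<in> SU4" "\<forall>l\<in>I. B$l = mat 1 $ l" "i \<notin> I" "insert i I \<noteq> UNIV"
  shows "\<exists>E \<in> mat_products two_level_SU. B ** E \<in> SU4 \<and> (\<forall>l\<in>insert i I. (B ** E)$l = mat 1 $ l)"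
proof -
  define J where "J = - insert i I"
  have J: "finite J" "J \<noteq> {}" "i \<notin> J" "insert i J = - I"
    using assms(3,4) by (auto simp: J_def)
  obtain E r where E: "E \<in> mat_products two_level_SU" "\<forall>j\<in>J. (B ** E)$i$j = 0"
    "r \<ge> 0" "(B ** E)$i$i = of_real r"
    "\<forall>k j. j \<in> I \<longrightarrow> (B ** E)$k$j = B$k$j"
    "\<forall>k. (\<forall>j\<in>-I. B$k$j = 0) \<longrightarrow> (\<forall>j\<in>-I. (B ** E)$k$j = 0)"
    using two_level_products_clear_row[OF J(1-3), of B] unfolding J(4) by auto
  have BE: "B ** E \<in> SU4"
    using SU4_mult[OF assms(1)] E(1) mat_products_SU4[OF two_level_SU_subset_SU4] by blast
  have row: "B$l$j = (if l = j then 1 else 0)" if "l \<in> I" for l j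
    using assms(2) that by (simp add: vec_eq_iff mat_def)
  have column: "B$k$l = 0" if "l \<in> I" "k \<noteq> l" for k l
    using unitary_unit_row(2)[of B 1 l k] assms(1) row that by (simp add: SU4_iff)
  have "(B ** E)$l$j = (if l = j then 1 else 0)" if "l \<in> I" for l j
  proof (cases "j \<in> I")
    case True
    then show ?thesis
      using E(5) row that by simp
  next
    case False
    then have "\<forall>j\<in>-I. B$l$j = 0"
      using row that by auto
    then show ?thesis
      using E(6) False that by auto
  qed
  then have rows: "(B ** E)$l = mat 1 $ l" if "l \<in> I" for l
    using that by (simp add: vec_eq_iff mat_def)
  have "(B ** E)$i = mat 1 $ i"
    using BE E(2-5) column assms(3)
    by (intro unitary_unit_row(1)[of _ r]) (auto simp: SU4_iff J_def)
  then show ?thesis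
    using E(1) BE rows by blast
qed

lemma SU4_first_rows_eq_1:
  assumes "B \<in> SU4" "B$0 = mat 1 $ 0" "B$1 = mat 1 $ 1" "B$2 = mat 1 $ 2"
  shows "B = mat 1"
proof -
  have row: "B$i$j = (if i = j then 1 else 0)" if "i \<noteq> 3" for i j
  proof -
    have "i \<in> {0, 1, 2, 3}"
      by (simp only: UNIV_4_from_0[symmetric] UNIV_I)
    then have "i = 0 \<or> i = 1 \<or> i = 2"
      using that by blast
    then show ?thesis
      using assms(2-4) by (auto simp: vec_eq_iff mat_def)
  qed
  have column: "B$k$j = 0" if "j \<noteq> 3" "k \<noteq> j" for j k
    using unitary_unit_row(2)[of B 1 j k] assms(1) that row by (simp add: SU4_iff)
  have offdiag: "B$i$j = 0" if "i \<noteq> j" for i j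
    using that row[of i j] column[of j i] by (cases "i = 3") simp_all
  have "det B = prod (\<lambda>i. B$i$i) UNIV"
    using offdiag by (rule det_diagonal)
  also have "\<dots> = prod (\<lambda>i :: 4. if i = 3 then B$3$3 else 1) UNIV"
    by (rule prod.cong) (simp_all add: row)
  also have "\<dots> = B$3$3"
    by (simp add: prod.delta)
  finally have "B$3$3 = 1"
    using assms(1) by (simp add: SU4_iff)
  show ?thesis
  proof (rule cmat4_eqI)
    fix i j
    show "B$i$j = mat 1 $ i $ j"
      using row[of i j] offdiag \<open>B$3$3 = 1\<close> by (cases "i = 3"; cases "i = j") (simp_all add: mat_def)
  qed
qed

lemma SU4_subset_two_level_products: "SU4 \<subseteq> mat_products two_level_SU"
proof
  fix A assume "A \<in> SU4"
  have new: "(1 :: 4) \<notin> {0}" "(2 :: 4) \<notin> insert 1 {0}"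
    by simp_all
  have "(3 :: 4) \<notin> {0, 1, 2}"
    by simp
  then have proper: "insert 0 {} \<noteq> (UNIV :: 4 set)" "insert 1 {0} \<noteq> (UNIV :: 4 set)"
    "insert 2 (insert 1 {0}) \<noteq> (UNIV :: 4 set)"
    by blast+
  obtain E1 where E1: "E1 \<in> mat_products two_level_SU" "A ** E1 \<in> SU4"
    "\<forall>l\<in>insert 0 {}. (A ** E1)$l = mat 1 $ l"
    using two_level_products_next_row[OF \<open>A \<in> SU4\<close> _ _ proper(1)] by blast
  obtain E2 where E2: "E2 \<in> mat_products two_level_SU" "A ** E1 ** E2 \<in> SU4"
    "\<forall>l\<in>insert 1 {0}. (A ** E1 ** E2)$l = mat 1 $ l"
    using two_level_products_next_row[OF E1(2) E1(3) new(1) proper(2)] by blast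
  obtain E3 where E3: "E3 \<in> mat_products two_level_SU" "A ** E1 ** E2 ** E3 \<in> SU4"
    "\<forall>l\<in>insert 2 (insert 1 {0}). (A ** E1 ** E2 ** E3)$l = mat 1 $ l"
    using two_level_products_next_row[OF E2(2) E2(3) new(2) proper(3)] by blast
  define E where "E = E1 ** E2 ** E3"
  have E: "E \<in> mat_products two_level_SU"
    unfolding E_def by (intro mat_products_mult E1(1) E2(1) E3(1))
  have "A ** E1 ** E2 ** E3 = mat 1"
    using E3(3) by (intro SU4_first_rows_eq_1[OF E3(2)]) simp_all
  then have "A ** E = mat 1"
    by (simp add: E_def matrix_mul_assoc)
  have "E ** conj_transpose E = mat 1"
    using mat_products_SU4[OF two_level_SU_subset_SU4] E by (auto simp: SU4_iff unitary_def)
  then have "A = (A ** E) ** conj_transpose E"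
    by (simp flip: matrix_mul_assoc)
  with \<open>A ** E = mat 1\<close> have "A = conj_transpose E"
    by simp
  then show "A \<in> mat_products two_level_SU"
    using conj_transpose_mat_products[OF conj_transpose_two_level_SU E] by simp
qed

theorem mainTheorem7:
  shows "real_lie_gen {gU, gY, gT, gX, gV, gZ} = su4
         \<and> (\<forall>A \<in> SU4. \<exists>gs. set gs \<subseteq> gate_set \<and> A = foldr (**) gs (mat 1))"
proof
  show "real_lie_gen {gU, gY, gT, gX, gV, gZ} = su4"
    by (rule real_lie_gen_generators_eq_su4)
  have "SU4 \<subseteq> mat_products gate_set"
    using SU4_subset_two_level_products mat_products_subset[OF two_level_SU_subset_gates]
    by blast
  then show "\<forall>A \<in> SU4. \<exists>gs. set gs \<subseteq> gate_set \<and> A = foldr (**) gs (mat 1)"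
    by (auto simp flip: mat_products_eq_foldr)
qed

end
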